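(* A disconnected finite poset $P$ is LE-primitive if and only if $P=C_{n_1}+C_{n_2}$ (a disjoint union of two chains with $n_1,n_2\ge1$) where $n_1\neq n_2$ or $n_1=n_2=1$.
   Context: For a finite poset $P$ with $n$ elements, a linear extension is a list $(p_1,\dots,p_n)$ of all elements of $P$ with $p_a<_P p_b$ implying $a<b$; ${\mathcal{L}}(P)$ is the set of these. For $1\le i\le n-1$, the Bender--Knuth move $t_i$ acts on ${\mathcal{L}}(P)$ by swapping $p_i,p_{i+1}$ if they are incomparable and fixing the list otherwise. $\mathcal{BK}_P\le{\mathfrak{S}}_{{\mathcal{L}}(P)}$ is the group generated by the $t_i$. $P$ is LE-primitive if $\mathcal{BK}_P$ acts primitively on ${\mathcal{L}}(P)$, i.e. preserves no partition of ${\mathcal{L}}(P)$ other than the partition into singletons and the one-block partition. $C_m$ denotes an $m$-element chain and $+$ disjoint union. *)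

theory Defs
  imports "HOL-Algebra.Bij" "HOL-Algebra.Generated_Groups" "HOL-Library.Disjoint_Sets"
begin

text \<open>
  A poset is a pair of a carrier \<open>A\<close> and a reflexive order relation \<open>r\<close> with
  \<open>partial_order_on A r\<close>; \<open>(x, y) \<in> r\<close> means \<open>x \<le> y\<close>, so \<open>x < y\<close> is
  \<open>(x, y) \<in> r \<and> x \<noteq> y\<close>.
\<close>

definition linear_extensions :: "'a set \<Rightarrow> 'a rel \<Rightarrow> 'a list set" where
  "linear_extensions A r =
    {p. distinct p \<and> set p = A \<and>
        (\<forall>a < length p. \<forall>b < length p. (p ! a, p ! b) \<in> r \<and> p ! a \<noteq> p ! b \<longrightarrow> a < b)}"

definition incomparable :: "'a rel \<Rightarrow> 'a \<Rightarrow> 'a \<Rightarrow> bool" where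
  "incomparable r x y \<longleftrightarrow> (x, y) \<notin> r \<and> (y, x) \<notin> r"

text \<open>
  The move \<open>t\<^sub>i\<close> is numbered from 1, whereas list positions are numbered from 0: it
  concerns the list positions \<open>i - 1\<close> and \<open>i\<close>.
\<close>

definition bk_move :: "'a rel \<Rightarrow> nat \<Rightarrow> 'a list \<Rightarrow> 'a list" where
  "bk_move r i p =
    (if incomparable r (p ! (i - 1)) (p ! i)
     then p[i - 1 := p ! i, i := p ! (i - 1)] else p)"

text \<open>
  \<open>BijGroup S\<close> is the symmetric group on \<open>S\<close>; its elements are extensional functions,
  hence the restriction of the moves to the set of linear extensions.
\<close>

definition bk_group :: "'a set \<Rightarrow> 'a rel \<Rightarrow> ('a list \<Rightarrow> 'a list) set" where
  "bk_group A r =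
    generate (BijGroup (linear_extensions A r))
      ((\<lambda>i. restrict (bk_move r i) (linear_extensions A r)) ` {1..card A - 1})"

definition preserves_partition :: "('b \<Rightarrow> 'b) set \<Rightarrow> 'b set set \<Rightarrow> bool" where
  "preserves_partition G Q \<longleftrightarrow> (\<forall>g \<in> G. \<forall>B \<in> Q. g ` B \<in> Q)"

definition acts_primitively :: "('b \<Rightarrow> 'b) set \<Rightarrow> 'b set \<Rightarrow> bool" where
  "acts_primitively G X \<longleftrightarrow>
    (\<forall>Q. partition_on X Q \<and> preserves_partition G Q \<longrightarrow> Q = (\<lambda>x. {x}) ` X \<or> Q = {X})"

definition LE_primitive :: "'a set \<Rightarrow> 'a rel \<Rightarrow> bool" where
  "LE_primitive A r \<longleftrightarrow> acts_primitively (bk_group A r) (linear_extensions A r)"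

text \<open>
  Disconnected: a disjoint union of two nonempty posets. In particular the empty poset
  is not disconnected.
\<close>

definition poset_disconnected :: "'a set \<Rightarrow> 'a rel \<Rightarrow> bool" where
  "poset_disconnected A r \<longleftrightarrow>
    (\<exists>B C. B \<noteq> {} \<and> C \<noteq> {} \<and> B \<union> C = A \<and> B \<inter> C = {} \<and> (\<forall>b \<in> B. \<forall>c \<in> C. incomparable r b c))"

definition poset_iso :: "'a set \<Rightarrow> 'a rel \<Rightarrow> 'b set \<Rightarrow> 'b rel \<Rightarrow> bool" where
  "poset_iso A r B s \<longleftrightarrow>
    (\<exists>f. bij_betw f A B \<and> (\<forall>x \<in> A. \<forall>y \<in> A. (x, y) \<in> r \<longleftrightarrow> (f x, f y) \<in> s))"

definition chain_rel :: "nat \<Rightarrow> nat rel" where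
  "chain_rel m = {(i, j). i \<le> j \<and> j < m}"

definition disjoint_sum_rel :: "'a rel \<Rightarrow> 'b rel \<Rightarrow> ('a + 'b) rel" where
  "disjoint_sum_rel r s = map_prod Inl Inl ` r \<union> map_prod Inr Inr ` s"

definition is_sum_of_two_chains :: "'a set \<Rightarrow> 'a rel \<Rightarrow> nat \<Rightarrow> nat \<Rightarrow> bool" where
  "is_sum_of_two_chains A r m n \<longleftrightarrow>
    poset_iso A r ({..<m} <+> {..<n}) (disjoint_sum_rel (chain_rel m) (chain_rel n))"

text \<open>
  The generators are permutations of the linear extensions, so that \<open>bk_group\<close> is a
  subgroup of the symmetric group.
\<close>

lemma bk_move_linear_extension:
  assumes "p \<in> linear_extensions A r" "finite A" "i \<in> {1..card A - 1}"
  shows "bk_move r i p \<in> linear_extensions A r"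
    and "bk_move r i (bk_move r i p) = p"
proof -
  have d: "distinct p" and s: "set p = A"
    and o: "\<And>a b. a < length p \<Longrightarrow> b < length p \<Longrightarrow> (p ! a, p ! b) \<in> r \<Longrightarrow> p ! a \<noteq> p ! b \<Longrightarrow> a < b"
    using assms(1) by (auto simp: linear_extensions_def)
  have len: "length p = card A" using d s distinct_card by fastforce
  have i: "i - 1 < length p" "i < length p" "i - 1 \<noteq> i" using assms(3) len by auto
  show "bk_move r i p \<in> linear_extensions A r"
  proof (cases "incomparable r (p ! (i - 1)) (p ! i)")
    case True
    let ?q = "p[i - 1 := p ! i, i := p ! (i - 1)]"
    have "distinct ?q" "set ?q = A"
      using i d s by (simp_all add: distinct_swap set_swap)
    moreover have "a < b" if "a < length ?q" "b < length ?q" "(?q ! a, ?q ! b) \<in> r" "?q ! a \<noteq> ?q ! b" for a b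
    proof -
      define \<sigma> where "\<sigma> k = (if k = i then i - 1 else if k = i - 1 then i else k)" for k
      have q: "?q ! k = p ! \<sigma> k" if "k < length p" for k
        using i that by (auto simp: \<sigma>_def nth_list_update)
      have l: "\<sigma> a < length p" "\<sigma> b < length p" using i that by (auto simp: \<sigma>_def)
      have "\<sigma> a < \<sigma> b" using o[OF l] that q by auto
      moreover have "\<not> (\<sigma> a = i - 1 \<and> \<sigma> b = i)"
        using True that q by (auto simp: incomparable_def)
      ultimately show ?thesis using i by (auto simp: \<sigma>_def split: if_splits)
    qed
    ultimately show ?thesis using True by (auto simp: bk_move_def linear_extensions_def)
  qed (use assms in \<open>simp add: bk_move_def\<close>)
  show "bk_move r i (bk_move r i p) = p"
    using i by (auto simp: bk_move_def incomparable_def list_eq_iff_nth_eq nth_list_update)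
qed

lemma bk_move_Bij:
  assumes "finite A" "i \<in> {1..card A - 1}"
  shows "restrict (bk_move r i) (linear_extensions A r) \<in> Bij (linear_extensions A r)"
proof -
  have "bij_betw (bk_move r i) (linear_extensions A r) (linear_extensions A r)"
    by (rule bij_betwI[where g = "bk_move r i"])
       (use bk_move_linear_extension[OF _ assms] in auto)
  then show ?thesis by (simp add: Bij_def)
qed

lemma subgroup_bk_group:
  assumes "finite A"
  shows "subgroup (bk_group A r) (BijGroup (linear_extensions A r))"
  unfolding bk_group_def
  by (rule group.generate_is_subgroup[OF group_BijGroup])
     (use bk_move_Bij[OF assms] in \<open>auto simp: BijGroup_def\<close>)

end

theory Submission
  imports Defs "HOL-Combinatorics.Transposition"
begin

text \<open>
  Let \<open>A = B + C\<close>. A move swaps neighbours from different summands unconditionally, so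
  recording which list positions carry elements of \<open>B\<close> turns \<open>t\<^sub>i\<close> into the transposition
  of positions \<open>i - 1\<close> and \<open>i\<close> acting on \<open>card B\<close>-subsets of \<open>{..<card A}\<close>. The fibres of
  this map are a preserved partition, which forces \<open>B\<close> and \<open>C\<close> to be chains; if
  \<open>card B = card C \<ge> 2\<close>, pairing a subset with its complement gives another one.
  Conversely, for chains the linear extensions are identified with the subsets. If two different
  subsets \<open>S\<close>, \<open>T\<close> are equivalent, a transposition that fixes one of them and exchanges one
  element of the other yields two equivalent subsets at distance one; such a transposition exists
  unless \<open>S\<close> and \<open>T\<close> are complementary. Transpositions fixing a subset permute its
  neighbours transitively, so all its neighbours are equivalent to it, and the graph of neighbours
  is connected.
\<close>

section \<open>Linear extensions\<close>

text \<open>This is the contrapositive of the index condition, where distinctness turns unequal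
  entries into unequal indices. The \<open>sorted_wrt\<close> form splits directly over
  concatenation.\<close>

lemma linear_extensions_iff:
  "p \<in> linear_extensions A r \<longleftrightarrow>
    distinct p \<and> set p = A \<and> sorted_wrt (\<lambda>x y. (y, x) \<notin> r) p"
proof -
  have "(\<forall>a < length p. \<forall>b < length p. (p ! a, p ! b) \<in> r \<and> p ! a \<noteq> p ! b \<longrightarrow> a < b)
      \<longleftrightarrow> sorted_wrt (\<lambda>x y. (y, x) \<notin> r) p" (is "?l \<longleftrightarrow> ?r") if "distinct p"
  proof
    assume ?l
    then show ?r
      unfolding sorted_wrt_iff_nth_less
      using that by (metis less_trans nat_neq_iff nth_eq_iff_index_eq)
  next
    assume ?r
    then show ?l
      unfolding sorted_wrt_iff_nth_less by (metis linorder_neqE_nat)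
  qed
  then show ?thesis
    by (auto simp: linear_extensions_def)
qed

lemma length_linear_extension:
  "p \<in> linear_extensions A r \<Longrightarrow> length p = card A"
  by (auto simp: linear_extensions_iff distinct_card)

lemma linear_extension_append:
  assumes "p \<in> linear_extensions B r" "q \<in> linear_extensions C r"
    and "B \<inter> C = {}" "\<And>b c. b \<in> B \<Longrightarrow> c \<in> C \<Longrightarrow> (c, b) \<notin> r"
  shows "p @ q \<in> linear_extensions (B \<union> C) r"
  using assms by (auto simp: linear_extensions_iff sorted_wrt_append)

text \<open>Elements with equal keys are never strictly related, so ties may be broken arbitrarily.
  The choice of key controls which linear extension is produced.\<close>

lemma linear_extension_sort_key:
  fixes k :: "'a \<Rightarrow> nat"
  assumes "finite A"
    and "\<And>x y. x \<in> A \<Longrightarrow> y \<in> A \<Longrightarrow> (x, y) \<in> r \<Longrightarrow> x \<noteq> y \<Longrightarrow> k x < k y"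
  obtains p where "p \<in> linear_extensions A r" "sorted (map k p)"
proof -
  obtain xs where xs: "set xs = A" "distinct xs"
    using finite_distinct_list[OF assms(1)] by blast
  define p where "p = sort_key k xs"
  have p: "set p = A" "distinct p" "sorted (map k p)"
    using xs by (simp_all add: p_def)
  have "sorted_wrt (\<lambda>x y. (y, x) \<notin> r) p"
    unfolding sorted_wrt_iff_nth_less
  proof (intro allI impI notI)
    fix i j assume ij: "i < j" "j < length p" and "(p ! j, p ! i) \<in> r"
    moreover have "p ! j \<noteq> p ! i" "p ! i \<in> A" "p ! j \<in> A"
      using ij p nth_mem[of _ p] by (auto simp: nth_eq_iff_index_eq)
    ultimately have "k (p ! j) < k (p ! i)"
      using assms(2) by blast
    then show False
      using sorted_nth_mono[OF p(3), of i j] ij by simp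
  qed
  then show thesis
    using p that by (auto simp: linear_extensions_iff)
qed

text \<open>By transitivity the first down-set lies in the second, and by antisymmetry it misses
  \<open>y\<close>. Hence the size of the down-set can serve as a sorting key.\<close>

lemma card_down_set_less:
  assumes "finite A" "partial_order_on A r" "x \<in> A" "y \<in> A" "(x, y) \<in> r" "x \<noteq> y"
  shows "card {z \<in> A. (z, x) \<in> r} < card {z \<in> A. (z, y) \<in> r}"
proof (rule psubset_card_mono)
  have o: "refl_on A r" "trans r" "antisym r"
    using assms(2) by (auto simp: partial_order_on_def preorder_on_def)
  have "y \<in> {z \<in> A. (z, y) \<in> r}" "y \<notin> {z \<in> A. (z, x) \<in> r}"
    using o assms by (auto dest: antisymD refl_onD)
  moreover have "{z \<in> A. (z, x) \<in> r} \<subseteq> {z \<in> A. (z, y) \<in> r}"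
    using assms(5) o(2) by (auto dest: transD)
  ultimately show "{z \<in> A. (z, x) \<in> r} \<subset> {z \<in> A. (z, y) \<in> r}"
    by blast
qed (use assms in simp)

lemma linear_extensions_nonempty:
  assumes "finite A" "partial_order_on A r" "B \<subseteq> A"
  shows "linear_extensions B r \<noteq> {}"
proof -
  let ?k = "\<lambda>x. card {z \<in> A. (z, x) \<in> r}"
  have "?k x < ?k y" if "x \<in> B" "y \<in> B" "(x, y) \<in> r" "x \<noteq> y" for x y
    using card_down_set_less[OF assms(1,2), of x y] that assms(3) by auto
  then show ?thesis
    using linear_extension_sort_key[OF finite_subset[OF assms(3,1)], of r ?k] by blast
qed

text \<open>
  The key counts the elements of the down-set, plus \<open>card A\<close> on the up-set of \<open>y\<close>; this
  moves everything above \<open>y\<close> behind \<open>x\<close>.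
\<close>
lemma linear_extension_before:
  assumes "finite A" "partial_order_on A r" "B \<subseteq> A" "x \<in> B" "y \<in> B" "(y, x) \<notin> r"
  obtains p i j where "p \<in> linear_extensions B r" "i < j" "j < length p" "p ! i = x" "p ! j = y"
proof -
  have o: "refl_on A r" "trans r" "antisym r"
    using assms(2) by (auto simp: partial_order_on_def preorder_on_def)
  define f where "f z = card {w \<in> A. (w, z) \<in> r}" for z
  define k where "k z = f z + (if (y, z) \<in> r then card A else 0)" for z
  have fin: "finite B"
    using assms finite_subset by blast
  have "k u < k v" if "u \<in> B" "v \<in> B" "(u, v) \<in> r" "u \<noteq> v" for u v
  proof -
    have "f u < f v"
      unfolding f_def using card_down_set_less[OF assms(1,2), of u v] that assms(3) by auto
    moreover have "(y, u) \<in> r \<longrightarrow> (y, v) \<in> r"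
      using that(3) o(2) by (auto dest: transD)
    ultimately show ?thesis
      by (auto simp: k_def)
  qed
  then obtain p where p: "p \<in> linear_extensions B r" "sorted (map k p)"
    using linear_extension_sort_key[OF fin] by blast
  have y: "y \<in> A" "(y, y) \<in> r"
    using o assms by (auto dest: refl_onD)
  then have "0 < f y"
    unfolding f_def using assms(1) by (auto simp: card_gt_0_iff)
  moreover have "f x \<le> card A"
    unfolding f_def using assms(1) by (auto intro: card_mono)
  \<comment> \<open>Since \<open>(y, x) \<notin> r\<close>, the value \<open>k x = f x\<close> is at
    most \<open>card A\<close>, whereas \<open>k y\<close> is \<open>card A\<close> plus a positive
    number.\<close>
  ultimately have less: "k x < k y"
    using y assms(6) by (simp add: k_def)
  obtain i j where ij: "i < length p" "j < length p" "p ! i = x" "p ! j = y"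
    using p assms(4,5) by (metis in_set_conv_nth linear_extensions_iff)
  have "i < j"
  proof (rule ccontr)
    assume "\<not> i < j"
    then have "k y \<le> k x"
      using sorted_nth_mono[OF p(2), of j i] ij by simp
    then show False
      using less by simp
  qed
  then show thesis
    using that p ij by blast
qed

text \<open>Two incomparable elements appear in either order in suitable linear extensions, so there
  would be at least two of these.\<close>

lemma chain_if_unique_linear_extension:
  assumes "finite A" "partial_order_on A r" "B \<subseteq> A" "x \<in> B" "y \<in> B"
    and uniq: "\<And>p q. p \<in> linear_extensions B r \<Longrightarrow> q \<in> linear_extensions B r \<Longrightarrow> p = q"
  shows "\<not> incomparable r x y"
proof
  assume "incomparable r x y"
  then have "(y, x) \<notin> r" "(x, y) \<notin> r"
    by (auto simp: incomparable_def)
  then obtain p i j q i' j' where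
    "p \<in> linear_extensions B r" "i < j" "j < length p" "p ! i = x" "p ! j = y"
    "q \<in> linear_extensions B r" "i' < j'" "j' < length q" "q ! i' = y" "q ! j' = x"
    using linear_extension_before[OF assms(1-3)] assms(4,5) by metis
  moreover from this have "p = q" "distinct p"
    using uniq by (auto simp: linear_extensions_iff)
  ultimately show False
    by (metis less_asym less_trans nth_eq_iff_index_eq)
qed

section \<open>Primitivity in terms of invariant equivalence relations\<close>

text \<open>Invariance is stated as an equivalence so that it passes to inverses. Membership in
  \<open>Bij X\<close> is carried through the induction because products need their factors to map
  \<open>X\<close> into itself.\<close>

lemma generate_BijGroup_respects:
  assumes equiv: "equiv X E"
    and S: "S \<subseteq> Bij X"
    and resp: "\<And>g p q. g \<in> S \<Longrightarrow> p \<in> X \<Longrightarrow> q \<in> X \<Longrightarrow> (g p, g q) \<in> E \<longleftrightarrow> (p, q) \<in> E"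
    and g: "g \<in> generate (BijGroup X) S"
  shows "g \<in> Bij X \<and> (\<forall>p \<in> X. \<forall>q \<in> X. (g p, g q) \<in> E \<longleftrightarrow> (p, q) \<in> E)"
  using g
proof induction
  case one
  then show ?case
    using id_Bij[of X] by (simp add: BijGroup_def restrict_def)
next
  case (incl h)
  then show ?case
    using S resp by blast
next
  case (inv h)
  then have h: "h \<in> Bij X"
    using S by blast
  have i: "inv\<^bsub>BijGroup X\<^esub> h = (\<lambda>x \<in> X. inv_into X h x)"
    using h by (rule inv_BijGroup)
  have "h ` X = X"
    using h by (simp add: Bij_def bij_betw_def)
  then have "inv_into X h p \<in> X" "h (inv_into X h p) = p" if "p \<in> X" for p
    using that by (simp_all add: inv_into_into f_inv_into_f)
  then have "(inv_into X h p, inv_into X h q) \<in> E \<longleftrightarrow> (p, q) \<in> E" if "p \<in> X" "q \<in> X" for p q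
    using resp[OF inv, of "inv_into X h p" "inv_into X h q"] that by simp
  then show ?case
    unfolding i by (intro conjI restrict_inv_into_Bij[OF h]) simp
next
  case (eng h1 h2)
  then have "h1 \<otimes>\<^bsub>BijGroup X\<^esub> h2 = compose X h1 h2"
    by (auto simp: BijGroup_def)
  moreover have "h2 p \<in> X" if "p \<in> X" for p
    using eng that by (auto simp: Bij_def bij_betw_def)
  ultimately show ?case
    using eng compose_Bij[of h1 X h2] by (simp add: compose_eq)
qed

text \<open>Partitions are exchanged for equivalence relations by taking quotients; invariance then
  needs to be tested only on the generating moves.\<close>

lemma LE_primitive_iff_equiv:
  fixes A :: "'a set" and r :: "'a rel"
  assumes "finite A"
  defines "X \<equiv> linear_extensions A r"
  shows "LE_primitive A r \<longleftrightarrow>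
    (\<forall>E. equiv X E \<and>
         (\<forall>i \<in> {1..card A - 1}. \<forall>(p, q) \<in> E. (bk_move r i p, bk_move r i q) \<in> E)
       \<longrightarrow> E = Id_on X \<or> E = X \<times> X)" (is "_ \<longleftrightarrow> ?R")
proof
  assume prim: "LE_primitive A r"
  show ?R
  proof (intro allI impI, elim conjE)
    fix E
    assume eq: "equiv X E"
      and inv: "\<forall>i \<in> {1..card A - 1}. \<forall>(p, q) \<in> E. (bk_move r i p, bk_move r i q) \<in> E"
    let ?S = "(\<lambda>i. restrict (bk_move r i) X) ` {1..card A - 1}"
    have S: "?S \<subseteq> Bij X"
      using bk_move_Bij[OF assms(1)] by (auto simp: X_def)
    have sub: "E \<subseteq> X \<times> X"
      using eq by (auto elim: equivE)
    \<comment> \<open>Each move is an involution on \<open>X\<close>, so applying it twice yields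
      the converse implication.\<close>
    have "(bk_move r i p, bk_move r i q) \<in> E \<longleftrightarrow> (p, q) \<in> E"
      if "i \<in> {1..card A - 1}" "p \<in> X" "q \<in> X" for i p q
      using inv bk_move_linear_extension(2)[OF _ assms(1) that(1)] that unfolding X_def
      by (metis (no_types, lifting) case_prodD)
    then have gen: "(g p, g q) \<in> E \<longleftrightarrow> (p, q) \<in> E" if "g \<in> ?S" "p \<in> X" "q \<in> X" for g p q
      using that by auto
    have resp: "g \<in> Bij X \<and> (\<forall>p \<in> X. \<forall>q \<in> X. (g p, g q) \<in> E \<longleftrightarrow> (p, q) \<in> E)"
      if "g \<in> bk_group A r" for g
      by (rule generate_BijGroup_respects[OF eq S gen that[unfolded bk_group_def, folded X_def]])
    have "preserves_partition (bk_group A r) (X // E)"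
      unfolding preserves_partition_def
    proof (intro ballI)
      fix g K assume g: "g \<in> bk_group A r" and "K \<in> X // E"
      then obtain p where p: "p \<in> X" "K = E `` {p}"
        by (auto elim: quotientE)
      have bij: "g ` X = X"
        using resp[OF g] by (auto simp: Bij_def bij_betw_def)
      have "g ` K = E `` {g p}"
      proof
        show "g ` K \<subseteq> E `` {g p}"
          using p resp[OF g] sub by auto
        show "E `` {g p} \<subseteq> g ` K"
        proof
          fix y assume y: "y \<in> E `` {g p}"
          then have "y \<in> g ` X"
            using sub bij by auto
          then obtain q where "q \<in> X" "y = g q" ..
          then show "y \<in> g ` K"
            using p resp[OF g] y by auto
        qed
      qed
      moreover have "g p \<in> X"
        using bij p by blast
      ultimately show "g ` K \<in> X // E"
        by (auto intro: quotientI)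
    qed
    moreover have "partition_on X (X // E)"
      by (rule partition_on_quotient[OF eq])
    ultimately have cases: "X // E = (\<lambda>x. {x}) ` X \<or> X // E = {X}"
      using prim by (auto simp: LE_primitive_def acts_primitively_def X_def)
    have cls: "p \<in> E `` {p}" "E `` {p} \<in> X // E" if "p \<in> X" for p
      using equiv_class_self[OF eq that] quotientI[OF that] by auto
    show "E = Id_on X \<or> E = X \<times> X"
    proof (rule disjE[OF cases])
      assume *: "X // E = (\<lambda>x. {x}) ` X"
      have "(p, q) \<in> E \<longleftrightarrow> q = p" if "p \<in> X" for p q
      proof -
        have "E `` {p} \<in> (\<lambda>x. {x}) ` X"
          using cls(2)[OF that] * by simp
        then obtain x where "E `` {p} = {x}"
          by blast
        then have "E `` {p} = {p}"
          using cls(1)[OF that] by (metis singletonD)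
        then show ?thesis
          by (metis Image_singleton_iff singleton_iff)
      qed
      then have "E = Id_on X"
        using sub by auto
      then show ?thesis ..
    next
      assume *: "X // E = {X}"
      have "(p, q) \<in> E" if "p \<in> X" "q \<in> X" for p q
        using cls(2)[OF that(1)] * that(2) by (metis Image_singleton_iff singletonD)
      then have "E = X \<times> X"
        using sub by auto
      then show ?thesis ..
    qed
  qed
next
  assume R: ?R
  show "LE_primitive A r"
    unfolding LE_primitive_def acts_primitively_def X_def[symmetric]
  proof (intro allI impI, elim conjE)
    fix Q assume part: "partition_on X Q" and pres: "preserves_partition (bk_group A r) Q"
    define E where "E = {(p, q). \<exists>K \<in> Q. p \<in> K \<and> q \<in> K}"
    have eq: "equiv X E"
      unfolding E_def using equiv_partition_on[OF part] .
    have sub: "\<And>K. K \<in> Q \<Longrightarrow> K \<subseteq> X"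
      using part by (auto simp: partition_on_def)
    have "(bk_move r i p, bk_move r i q) \<in> E" if i: "i \<in> {1..card A - 1}" and pq: "(p, q) \<in> E" for i p q
    proof -
      obtain K where K: "K \<in> Q" "p \<in> K" "q \<in> K"
        using pq by (auto simp: E_def)
      have "restrict (bk_move r i) X \<in> bk_group A r"
        unfolding bk_group_def X_def by (rule generate.incl) (use i in blast)
      then have "restrict (bk_move r i) X ` K \<in> Q"
        using pres K by (auto simp: preserves_partition_def)
      moreover have "p \<in> X" "q \<in> X"
        using K sub by auto
      then have "bk_move r i p \<in> restrict (bk_move r i) X ` K" "bk_move r i q \<in> restrict (bk_move r i) X ` K"
        using K by (metis imageI restrict_apply')+
      ultimately show ?thesis
        unfolding E_def mem_Collect_eq case_prod_conv by blast
    qed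
    then have cases: "E = Id_on X \<or> E = X \<times> X"
      using R eq by blast
    have Q: "Q = X // E"
      unfolding E_def using partition_on_eq_quotient[OF part] by simp
    show "Q = (\<lambda>x. {x}) ` X \<or> Q = {X}"
    proof (rule disjE[OF cases])
      assume "E = Id_on X"
      then have "E `` {p} = {p}" if "p \<in> X" for p
        using that by auto
      then have "Q = (\<lambda>x. {x}) ` X"
        unfolding Q quotient_def by auto
      then show ?thesis ..
    next
      assume "E = X \<times> X"
      then have *: "E `` {p} = X" if "p \<in> X" for p
        using that by auto
      show ?thesis
      \<comment> \<open>The quotient of the empty set is empty, so in that case it is the set of
        singletons and not \<open>{X}\<close>.\<close>
      proof (cases "X = {}")
        case True
        then show ?thesis
          unfolding Q by (simp add: quotient_def)
      next
        case False
        then have "Q = {X}"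
          unfolding Q quotient_def using * by auto
        then show ?thesis ..
      qed
    qed
  qed
qed

section \<open>Positions of a summand\<close>

definition positions :: "'a set \<Rightarrow> 'a list \<Rightarrow> nat set" where
  "positions B p = {k. k < length p \<and> p ! k \<in> B}"

lemma positions_linear_extension:
  assumes "p \<in> linear_extensions A r"
  shows "positions B p \<subseteq> {..<card A}"
  using length_linear_extension[OF assms] by (auto simp: positions_def)

lemma finite_positions [simp]: "finite (positions B p)"
  by (simp add: positions_def)

text \<open>Indexing into the distinct list \<open>p\<close> maps these positions bijectively onto
  \<open>B\<close>.\<close>

lemma card_positions:
  assumes "p \<in> linear_extensions A r" "B \<subseteq> A"
  shows "card (positions B p) = card B"
proof -
  have p: "distinct p" "set p = A"
    using assms by (auto simp: linear_extensions_iff)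
  have "(!) p ` positions B p = B"
    using p assms(2) by (force simp: positions_def in_set_conv_nth)
  moreover have "inj_on ((!) p) (positions B p)"
    using p by (auto simp: positions_def inj_on_def nth_eq_iff_index_eq)
  ultimately show ?thesis
    by (metis card_image)
qed

lemma positions_append:
  assumes "set p = B" "set q \<inter> B = {}"
  shows "positions B (p @ q) = {..<length p}"
    and "positions B (q @ p) = {length q..<length q + length p}"
proof -
  have "p ! k \<in> B" if "k < length p" for k
    using that assms(1) by auto
  moreover have "q ! k \<notin> B" if "k < length q" for k
    using that assms(2) nth_mem[of k q] by blast
  ultimately show "positions B (p @ q) = {..<length p}"
    and "positions B (q @ p) = {length q..<length q + length p}"
    by (auto simp: positions_def nth_append) (metis add_diff_inverse_nat nat_add_left_cancel_less)
qed

lemma equal_card_differ: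
  assumes "finite S" "finite T" "card S = card T" "S \<noteq> T"
  obtains x y where "x \<in> S - T" "y \<in> T - S"
  using assms by (metis DiffI card_subset_eq subsetI)

lemma mem_transpose_image:
  "k \<in> transpose a b ` S \<longleftrightarrow> transpose a b k \<in> S"
  by (metis imageE image_eqI transpose_involutory)

lemma transpose_image_exchange:
  assumes "a \<in> S" "b \<notin> S"
  shows "transpose a b ` S = insert b (S - {a})"
  using assms by (auto simp: transpose_def image_iff)

lemma transpose_image_diff:
  assumes "a \<in> U" "b \<in> U"
  shows "transpose a b ` (U - S) = U - transpose a b ` S"
  using assms by (simp add: image_set_diff)

section \<open>Disconnected posets and the necessary conditions\<close>

locale disjoint_posets =
  fixes A :: "'a set" and r :: "'a rel" and B C :: "'a set"
  assumes finite: "finite A" and order: "partial_order_on A r"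
    and nonempty: "B \<noteq> {}" "C \<noteq> {}" and union: "B \<union> C = A" and disjoint: "B \<inter> C = {}"
    and cross: "\<And>b c. b \<in> B \<Longrightarrow> c \<in> C \<Longrightarrow> incomparable r b c"
begin

abbreviation "X \<equiv> linear_extensions A r"

text \<open>Incomparability is symmetric, so results proved for \<open>B\<close> can be reused for
  \<open>C\<close>.\<close>

lemma swapped: "disjoint_posets A r C B"
  using finite order nonempty union disjoint cross
  by unfold_locales (auto simp: incomparable_def)

lemma card_A: "card A = card B + card C"
  using finite union disjoint card_Un_disjoint[of B C] by auto

lemma card_pos: "0 < card B" "0 < card C"
  using finite union nonempty by (auto simp: card_gt_0_iff)

text \<open>If the move swaps, the positions are transposed visibly. If it does not, the two entries
  are comparable and so come from the same summand; then the transposition leaves the position set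
  unchanged.\<close>

lemma positions_bk_move:
  assumes p: "p \<in> X" and i: "i \<in> {1..card A - 1}"
  shows "positions B (bk_move r i p) = transpose (i - 1) i ` positions B p"
proof -
  have l: "i - 1 < length p" "i < length p" "i - 1 \<noteq> i" and s: "set p = A"
    using p i length_linear_extension[OF p] by (auto simp: linear_extensions_iff)
  have mem: "p ! (i - 1) \<in> A" "p ! i \<in> A"
    using l s nth_mem by blast+
  define q where "q = p[i - 1 := p ! i, i := p ! (i - 1)]"
  have "length q = length p"
    by (simp add: q_def)
  moreover have "q ! k = p ! transpose (i - 1) i k" if "k < length p" for k
    using that l by (auto simp: q_def nth_list_update transpose_def)
  moreover have "transpose (i - 1) i k < length p \<longleftrightarrow> k < length p" for k
    using l by (auto simp: transpose_def)
  ultimately have "k \<in> positions B q \<longleftrightarrow> k \<in> transpose (i - 1) i ` positions B p" for k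
    unfolding mem_transpose_image positions_def mem_Collect_eq by metis
  then have swap: "positions B q = transpose (i - 1) i ` positions B p"
    by blast
  show ?thesis
  proof (cases "incomparable r (p ! (i - 1)) (p ! i)")
    case True
    then show ?thesis
      using swap by (simp add: bk_move_def q_def)
  next
    case False
    then have "p ! (i - 1) \<in> B \<longleftrightarrow> p ! i \<in> B"
      using mem cross union by (auto simp: incomparable_def)
    then have "i - 1 \<in> positions B p \<longleftrightarrow> i \<in> positions B p"
      using l by (auto simp: positions_def)
    then show ?thesis
      using False by (simp add: bk_move_def)
  qed
qed

text \<open>No relation crosses between the summands, so either may be listed first. The resulting
  initial and final segments are the witnesses in the nontriviality arguments below.\<close>

lemma append_linear_extension:
  assumes "p \<in> linear_extensions B r" "q \<in> linear_extensions C r"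
  shows "p @ q \<in> X" "q @ p \<in> X"
    and "positions B (p @ q) = {..<card B}" "positions B (q @ p) = {card C..<card A}"
proof -
  have CB: "C \<inter> B = {}" "C \<union> B = A"
    using disjoint union by auto
  have s: "set p = B" "set q \<inter> B = {}" and l: "length p = card B" "length q = card C"
    using assms CB by (auto simp: linear_extensions_iff length_linear_extension)
  show "p @ q \<in> X"
    using linear_extension_append[OF assms disjoint] cross union by (auto simp: incomparable_def)
  show "q @ p \<in> X"
    using linear_extension_append[OF assms(2,1) CB(1)] cross CB by (auto simp: incomparable_def)
  show "positions B (p @ q) = {..<card B}" "positions B (q @ p) = {card C..<card A}"
    using positions_append[OF s] l card_A by (simp_all add: add.commute)
qed

lemma linear_extensions_summands:
  obtains p q where "p \<in> linear_extensions B r" "q \<in> linear_extensions C r"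
  using linear_extensions_nonempty[OF finite order, of B]
    linear_extensions_nonempty[OF finite order, of C] union by blast

text \<open>Having equal positions is an invariant relation. It is not total, as listing
  \<open>B\<close> first or last gives different positions, so primitivity makes it the
  identity.\<close>

lemma LE_primitive_imp_positions_inj:
  assumes "LE_primitive A r" "p \<in> X" "q \<in> X" "positions B p = positions B q"
  shows "p = q"
proof -
  define E where "E = {(p, q). p \<in> X \<and> q \<in> X \<and> positions B p = positions B q}"
  have "equiv X E"
    by (rule equivI) (auto simp: E_def refl_on_def sym_def trans_def)
  moreover have "\<forall>i \<in> {1..card A - 1}. \<forall>(p, q) \<in> E. (bk_move r i p, bk_move r i q) \<in> E"
    using bk_move_linear_extension(1)[OF _ finite] positions_bk_move by (auto simp: E_def)
  ultimately have "E = Id_on X \<or> E = X \<times> X"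
    using assms(1) LE_primitive_iff_equiv[OF finite] by blast
  moreover have "E \<noteq> X \<times> X"
  proof
    assume full: "E = X \<times> X"
    obtain u v where "u \<in> linear_extensions B r" "v \<in> linear_extensions C r"
      by (rule linear_extensions_summands)
    note uv = append_linear_extension[OF this]
    have "(u @ v, v @ u) \<in> E"
      using full uv by blast
    then have "{..<card B} = {card C..<card A}"
      using uv by (simp add: E_def)
    \<comment> \<open>As \<open>C\<close> is nonempty, 0 is not in the final segment.\<close>
    moreover have "0 \<in> {..<card B}"
      using card_pos by simp
    ultimately show False
      using card_pos by auto
  qed
  ultimately show ?thesis
    using assms by (auto simp: E_def)
qed

text \<open>Two linear extensions of \<open>B\<close> followed by the same one of \<open>C\<close>
  have equal positions, hence coincide; so \<open>B\<close> has only one linear extension.\<close>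

lemma LE_primitive_imp_chain:
  assumes "LE_primitive A r" "x \<in> B" "y \<in> B"
  shows "\<not> incomparable r x y"
proof (rule chain_if_unique_linear_extension[OF finite order _ assms(2,3)])
  fix p q assume "p \<in> linear_extensions B r" "q \<in> linear_extensions B r"
  moreover obtain v where "v \<in> linear_extensions C r"
    by (rule linear_extensions_summands)
  ultimately have "p @ v = q @ v"
    using LE_primitive_imp_positions_inj[OF assms(1)] append_linear_extension by metis
  then show "p = q"
    by simp
qed (use union in blast)

text \<open>Transpositions commute with complements, so equal or complementary positions define an
  invariant relation. For two summands of the same size at least 2, it is neither the identity nor
  total.\<close>

lemma LE_primitive_imp_card:
  assumes "LE_primitive A r" "card B = card C"
  shows "card B = 1"
proof (rule ccontr)
  assume ne1: "card B \<noteq> 1"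
  let ?U = "{..<card A}"
  have sub: "positions B p \<subseteq> ?U" if "p \<in> X" for p
    using positions_linear_extension[OF that] .
  define E where "E = {(p, q). p \<in> X \<and> q \<in> X \<and>
    (positions B p = positions B q \<or> positions B p = ?U - positions B q)}"
  have "equiv X E"
  proof (rule equivI)
    show "sym E"
      using sub unfolding E_def sym_def by (auto simp: double_diff)
    show "trans E"
      using sub unfolding E_def trans_def by (auto simp: double_diff)
  qed (auto simp: E_def refl_on_def)
  moreover have inv: "\<forall>i \<in> {1..card A - 1}. \<forall>(p, q) \<in> E. (bk_move r i p, bk_move r i q) \<in> E"
  proof (intro ballI, clarify)
    fix i p q assume i: "i \<in> {1..card A - 1}" and pq: "(p, q) \<in> E"
    have "transpose (i - 1) i ` (?U - S) = ?U - transpose (i - 1) i ` S" for S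
      using i by (intro transpose_image_diff) auto
    moreover have X: "p \<in> X" "q \<in> X"
      and "positions B p = positions B q \<or> positions B p = ?U - positions B q"
      using pq by (simp_all add: E_def)
    ultimately show "(bk_move r i p, bk_move r i q) \<in> E"
      unfolding E_def mem_Collect_eq case_prod_conv positions_bk_move[OF X(1) i] positions_bk_move[OF X(2) i]
      using bk_move_linear_extension(1)[OF X(1) finite i] bk_move_linear_extension(1)[OF X(2) finite i]
      by metis
  qed
  ultimately have cases: "E = Id_on X \<or> E = X \<times> X"
    using assms(1) LE_primitive_iff_equiv[OF finite] by blast
  obtain u v where "u \<in> linear_extensions B r" "v \<in> linear_extensions C r"
    by (rule linear_extensions_summands)
  note uv = append_linear_extension[OF this]
  let ?n = "card B"
  have n: "2 \<le> ?n" "card A = ?n + ?n"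
    using ne1 card_pos card_A assms(2) by auto
  have compl: "?U - {?n..<card A} = {..<?n}"
    using n by auto
  have "(u @ v, v @ u) \<in> E"
    using uv compl assms(2) by (auto simp: E_def)
  moreover have "u @ v \<noteq> v @ u"
  proof
    assume "u @ v = v @ u"
    then have "{..<?n} = {?n..<card A}"
      using uv assms(2) by simp
    moreover have "0 \<in> {..<?n}"
      using n by simp
    ultimately show False
      using n by auto
  qed
  ultimately have full: "E = X \<times> X"
    using cases by auto
  \<comment> \<open>The move across the boundary exchanges list positions \<open>?n - 1\<close> and
    \<open>?n\<close>. Because \<open>?n\<close> is at least 2, position 0 stays, so the new
    position set meets both halves and is neither of them.\<close>
  have i: "?n \<in> {1..card A - 1}"
    using n by auto
  let ?w = "bk_move r ?n (u @ v)"
  have "positions B ?w = transpose (?n - 1) ?n ` {..<?n}"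
    using positions_bk_move[OF uv(1) i] uv by simp
  also have "\<dots> = insert ?n ({..<?n} - {?n - 1})"
    using n by (intro transpose_image_exchange) auto
  finally have w: "positions B ?w = insert ?n ({..<?n} - {?n - 1})" .
  have "(?w, u @ v) \<in> E"
    using full uv bk_move_linear_extension(1)[OF uv(1) finite i] by blast
  then have "insert ?n ({..<?n} - {?n - 1}) = {..<?n} \<or>
      insert ?n ({..<?n} - {?n - 1}) = ?U - {..<?n}"
    using w uv by (auto simp: E_def)
  moreover have "?n \<in> insert ?n ({..<?n} - {?n - 1})" "0 \<in> insert ?n ({..<?n} - {?n - 1})"
    "?n \<notin> {..<?n}" "0 \<notin> ?U - {..<?n}"
    using n by auto
  ultimately show False
    by metis
qed

end

section \<open>Two chains\<close>

text \<open>The rank counts strict predecessors within \<open>B\<close>, so it starts at 0. It is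
  strictly increasing, hence injective on a chain, and its values are below \<open>card B\<close>,
  so it is onto by counting.\<close>

lemma finite_chain_rank:
  assumes "finite B" "partial_order_on A r" "B \<subseteq> A"
    and chain: "\<And>x y. x \<in> B \<Longrightarrow> y \<in> B \<Longrightarrow> \<not> incomparable r x y"
  obtains h where "bij_betw h B {..<card B}"
    and "\<And>x y. x \<in> B \<Longrightarrow> y \<in> B \<Longrightarrow> (x, y) \<in> r \<longleftrightarrow> h x \<le> (h y :: nat)"
proof -
  have o: "refl_on A r" "trans r" "antisym r"
    using assms(2) by (auto simp: partial_order_on_def preorder_on_def)
  define h where "h x = card {z \<in> B. (z, x) \<in> r \<and> z \<noteq> x}" for x
  have less: "h x < h y" if "x \<in> B" "y \<in> B" "(x, y) \<in> r" "x \<noteq> y" for x y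
    unfolding h_def
  proof (rule psubset_card_mono)
    have "{z \<in> B. (z, x) \<in> r \<and> z \<noteq> x} \<subseteq> {z \<in> B. (z, y) \<in> r \<and> z \<noteq> y}"
      using that o by (auto dest: transD antisymD)
    moreover have "x \<in> {z \<in> B. (z, y) \<in> r \<and> z \<noteq> y}"
      using that by simp
    ultimately show "{z \<in> B. (z, x) \<in> r \<and> z \<noteq> x} \<subset> {z \<in> B. (z, y) \<in> r \<and> z \<noteq> y}"
      by blast
  qed (use assms in simp)
  have le: "(x, y) \<in> r \<longleftrightarrow> h x \<le> h y" if "x \<in> B" "y \<in> B" for x y
  proof (cases "x = y")
    case True
    then show ?thesis
      using that o assms(3) by (auto dest: refl_onD)
  next
    case False
    then show ?thesis
      using less[OF that] less[OF that(2,1)] chain[OF that] by (auto simp: incomparable_def)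
  qed
  have "inj_on h B"
    using less chain unfolding inj_on_def incomparable_def by (metis nat_neq_iff)
  moreover have "h ` B \<subseteq> {..<card B}"
  proof clarsimp
    fix x assume "x \<in> B"
    then have "{z \<in> B. (z, x) \<in> r \<and> z \<noteq> x} \<subset> B"
      by blast
    then show "h x < card B"
      unfolding h_def using assms(1) by (rule psubset_card_mono[rotated])
  qed
  ultimately have "bij_betw h B {..<card B}"
    unfolding bij_betw_def by (metis card_image card_lessThan card_subset_eq finite_lessThan)
  then show thesis
    using that le by blast
qed

lemma disjoint_sum_rel_simps [simp]:
  "(Inl x, Inl y) \<in> disjoint_sum_rel r s \<longleftrightarrow> (x, y) \<in> r"
  "(Inr u, Inr v) \<in> disjoint_sum_rel r s \<longleftrightarrow> (u, v) \<in> s"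
  "(Inl x, Inr v) \<notin> disjoint_sum_rel r s"
  "(Inr u, Inl y) \<notin> disjoint_sum_rel r s"
  by (auto simp: disjoint_sum_rel_def)

locale disjoint_chains = disjoint_posets +
  assumes chain: "\<And>x y. x \<in> B \<Longrightarrow> y \<in> B \<Longrightarrow> \<not> incomparable r x y"
    "\<And>x y. x \<in> C \<Longrightarrow> y \<in> C \<Longrightarrow> \<not> incomparable r x y"
begin

text \<open>The isomorphism glues the rank functions of the two chains.\<close>

lemma is_sum_of_two_chains: "is_sum_of_two_chains A r (card B) (card C)"
proof -
  have sub: "finite B" "finite C" "B \<subseteq> A" "C \<subseteq> A"
    using finite union by auto
  obtain h where h: "bij_betw h B {..<card B}"
    "\<And>x y. x \<in> B \<Longrightarrow> y \<in> B \<Longrightarrow> (x, y) \<in> r \<longleftrightarrow> h x \<le> (h y :: nat)"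
    using finite_chain_rank[OF sub(1) order sub(3) chain(1)] by blast
  obtain k where k: "bij_betw k C {..<card C}"
    "\<And>x y. x \<in> C \<Longrightarrow> y \<in> C \<Longrightarrow> (x, y) \<in> r \<longleftrightarrow> k x \<le> (k y :: nat)"
    using finite_chain_rank[OF sub(2) order sub(4) chain(2)] by blast
  define f where "f x = (if x \<in> B then Inl (h x) else Inr (k x))" for x
  have inj: "inj_on h B" "inj_on k C" and im: "h ` B = {..<card B}" "k ` C = {..<card C}"
    using h(1) k(1) by (auto simp: bij_betw_def)
  have f: "f x = Inl (h x)" "h x < card B" if "x \<in> B" for x
    using that im(1) by (auto simp: f_def)
  have f': "f x = Inr (k x)" "k x < card C" if "x \<in> C" for x
    using that im(2) disjoint by (auto simp: f_def)
  have "inj_on f A"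
    unfolding union[symmetric]
    by (rule inj_onI, elim UnE) (simp_all add: f f' inj_on_eq_iff[OF inj(1)] inj_on_eq_iff[OF inj(2)])
  moreover have "f ` B = Inl ` h ` B" "f ` C = Inr ` k ` C"
    by (simp_all add: image_image f f')
  then have "f ` A = {..<card B} <+> {..<card C}"
    unfolding union[symmetric] im by (simp add: image_Un Plus_def)
  moreover have "(x, y) \<in> r \<longleftrightarrow> (f x, f y) \<in> disjoint_sum_rel (chain_rel (card B)) (chain_rel (card C))"
    if xy: "x \<in> A" "y \<in> A" for x y
  proof -
    consider "x \<in> B" "y \<in> B" | "x \<in> C" "y \<in> C" | "x \<in> B" "y \<in> C" | "x \<in> C" "y \<in> B"
      using xy union by blast
    then show ?thesis
      by cases (use f f' h(2) k(2) cross in \<open>auto simp: chain_rel_def incomparable_def\<close>)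
  qed
  ultimately show ?thesis
    unfolding is_sum_of_two_chains_def poset_iso_def bij_betw_def by blast
qed

text \<open>Where two such lists first differ, both entries lie in the same chain and are therefore
  comparable. \<open>no_less\<close> excludes both directions.\<close>

lemma positions_inj:
  assumes p: "p \<in> X" and q: "q \<in> X" and eq: "positions B p = positions B q"
  shows "p = q"
proof (rule nth_equalityI)
  have len: "length p = card A" "length q = card A"
    using p q by (auto simp: length_linear_extension)
  then show "length p = length q"
    by simp
  \<comment> \<open>The entry \<open>v ! k\<close> occurs somewhere in \<open>u\<close>. Being below
    \<open>u ! k\<close> it would have to occur before place \<open>k\<close>, where
    \<open>u\<close> and \<open>v\<close> agree, so \<open>v\<close> would contain it twice.\<close>
  have no_less: "(v ! k, u ! k) \<notin> r"
    if u: "u \<in> X" and v: "v \<in> X" and k: "k < card A" "u ! k \<noteq> v ! k"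
      and prev: "\<And>j. j < k \<Longrightarrow> u ! j = v ! j" for u v k
  proof
    assume less: "(v ! k, u ! k) \<in> r"
    have uv: "set u = A" "set v = A" "distinct u" "distinct v" "length u = card A" "length v = card A"
      using u v by (auto simp: linear_extensions_iff length_linear_extension)
    obtain j where j: "j < card A" "u ! j = v ! k"
      using uv k nth_mem[of k v] by (metis in_set_conv_nth)
    have "sorted_wrt (\<lambda>x y. (y, x) \<notin> r) u"
      using u by (simp add: linear_extensions_iff)
    then have "\<not> k < j"
      using less j uv unfolding sorted_wrt_iff_nth_less by metis
    then have "j < k"
      using j k by (metis linorder_neqE_nat)
    then show False
      using prev[of j] j uv k by (auto simp: nth_eq_iff_index_eq)
  qed
  fix k assume "k < length p"
  then show "p ! k = q ! k"
  proof (induction k rule: less_induct)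
    case (less k)
    have k: "k < card A"
      using less.prems len by simp
    have mem: "p ! k \<in> A" "q ! k \<in> A"
      using k len p q nth_mem by (metis linear_extensions_iff)+
    have "p ! k \<in> B \<longleftrightarrow> q ! k \<in> B"
      using eq k len by (auto simp: positions_def set_eq_iff)
    then have "\<not> incomparable r (p ! k) (q ! k)"
      using mem chain union by blast
    moreover have "\<And>j. j < k \<Longrightarrow> p ! j = q ! j"
      using less by simp
    ultimately show ?case
      using no_less[OF p q k] no_less[OF q p k] unfolding incomparable_def by metis
  qed
qed

end

section \<open>Invariant equivalence relations for two chains\<close>

locale invariant_equiv = disjoint_chains +
  fixes E
  assumes equiv: "equiv X E"
    and invariant: "\<And>i p q. i \<in> {1..card A - 1} \<Longrightarrow> (p, q) \<in> E \<Longrightarrow> (bk_move r i p, bk_move r i q) \<in> E"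
begin

lemma E_refl: "p \<in> X \<Longrightarrow> (p, p) \<in> E"
  using equiv by (auto elim!: equivE dest: refl_onD)

lemma E_X: "(p, q) \<in> E \<Longrightarrow> p \<in> X \<and> q \<in> X"
  using equiv by (auto elim: equivE)

lemma E_sym: "(p, q) \<in> E \<Longrightarrow> (q, p) \<in> E"
  using equiv by (auto elim: equivE dest: symD)

lemma E_trans: "(p, q) \<in> E \<Longrightarrow> (q, s) \<in> E \<Longrightarrow> (p, s) \<in> E"
  using equiv by (auto elim: equivE dest: transD)

text \<open>An arbitrary transposition is obtained from adjacent ones by conjugation, by induction
  on the larger position. The map \<open>g\<close> is thus a composite of moves and inherits
  invariance from them.\<close>

lemma transposition_less:
  assumes "a < b" "b < card A"
  shows "\<exists>g. (\<forall>p \<in> X. g p \<in> X \<and> positions B (g p) = transpose a b ` positions B p) \<and>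
    (\<forall>p q. (p, q) \<in> E \<longrightarrow> (g p, g q) \<in> E)"
  using assms
proof (induction b)
  case (Suc b)
  have i: "Suc b \<in> {1..card A - 1}"
    using Suc.prems by auto
  let ?t = "bk_move r (Suc b)"
  have t: "?t p \<in> X" "positions B (?t p) = transpose b (Suc b) ` positions B p" if "p \<in> X" for p
    using bk_move_linear_extension(1)[OF that finite i] positions_bk_move[OF that i] by auto
  show ?case
  proof (cases "a = b")
    case True
    then show ?thesis
      using t invariant[OF i] by (intro exI[of _ ?t]) auto
  next
    case False
    then obtain g where
      g: "\<forall>p \<in> X. g p \<in> X \<and> positions B (g p) = transpose a b ` positions B p"
      "\<forall>p q. (p, q) \<in> E \<longrightarrow> (g p, g q) \<in> E"
      using Suc by auto
    have "transpose b (Suc b) \<circ> transpose a b \<circ> transpose b (Suc b) = transpose a (Suc b)"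
      using Suc.prems False by (auto simp: fun_eq_iff transpose_def)
    then have "transpose b (Suc b) ` transpose a b ` transpose b (Suc b) ` S = transpose a (Suc b) ` S" for S
      by (metis image_comp)
    then have "\<forall>p \<in> X. ?t (g (?t p)) \<in> X \<and>
        positions B (?t (g (?t p))) = transpose a (Suc b) ` positions B p"
      using t g(1) by simp
    moreover have "\<forall>p q. (p, q) \<in> E \<longrightarrow> (?t (g (?t p)), ?t (g (?t q))) \<in> E"
      using g(2) invariant[OF i] by blast
    ultimately show ?thesis
      by (intro exI[of _ "\<lambda>p. ?t (g (?t p))"] conjI)
  qed
qed simp

lemma transposition:
  assumes "a < card A" "b < card A"
  obtains g where "\<And>p. p \<in> X \<Longrightarrow> g p \<in> X"
    and "\<And>p. p \<in> X \<Longrightarrow> positions B (g p) = transpose a b ` positions B p"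
    and "\<And>p q. (p, q) \<in> E \<Longrightarrow> (g p, g q) \<in> E"
proof -
  have "\<exists>g. (\<forall>p \<in> X. g p \<in> X \<and> positions B (g p) = transpose a b ` positions B p) \<and>
    (\<forall>p q. (p, q) \<in> E \<longrightarrow> (g p, g q) \<in> E)"
  proof (rule linorder_cases[of a b])
    assume "a < b"
    then show ?thesis
      using assms(2) by (rule transposition_less)
  next
    assume "a = b"
    then show ?thesis
      by (intro exI[of _ "\<lambda>p. p"]) simp
  next
    assume "b < a"
    then show ?thesis
      using transposition_less[of b a] assms(1) by (simp add: transpose_commute[of a b])
  qed
  then obtain g where "\<forall>p \<in> X. g p \<in> X \<and> positions B (g p) = transpose a b ` positions B p"
    "\<forall>p q. (p, q) \<in> E \<longrightarrow> (g p, g q) \<in> E"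
    by (elim exE conjE)
  then show thesis
    by (intro that[of g]) simp_all
qed

text \<open>The transposition fixes the position set of \<open>p\<close>, hence fixes
  \<open>p\<close> itself by \<open>positions_inj\<close>. Applied to the pair, it therefore moves
  only the second component.\<close>

lemma fixed_by_transposition:
  assumes pq: "(p, q) \<in> E" and ab: "a < card A" "b < card A"
    and same: "a \<in> positions B p \<longleftrightarrow> b \<in> positions B p"
  obtains q' where "(p, q') \<in> E" "positions B q' = transpose a b ` positions B q"
proof -
  obtain g where g: "\<And>p. p \<in> X \<Longrightarrow> g p \<in> X"
    "\<And>p. p \<in> X \<Longrightarrow> positions B (g p) = transpose a b ` positions B p"
    "\<And>p q. (p, q) \<in> E \<Longrightarrow> (g p, g q) \<in> E"
    using transposition[OF ab] by metis
  have X: "p \<in> X" "q \<in> X"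
    using E_X[OF pq] by auto
  have "positions B (g p) = positions B p"
    using g(2)[OF X(1)] transpose_image_eq[OF same] by simp
  then have "g p = p"
    by (rule positions_inj[OF g(1)[OF X(1)] X(1)])
  then show thesis
    using g(3)[OF pq] g(2)[OF X(2)] that by simp
qed

text \<open>Exchanging one element is adjacency in the Johnson graph of
  \<open>card B\<close>-subsets of \<open>{..<card A}\<close>. One related neighbour is enough here;
  \<open>near_neighbour\<close> obtains all the others.\<close>

definition near :: "'a list \<Rightarrow> bool" where
  "near p \<longleftrightarrow> (\<exists>q x y. (p, q) \<in> E \<and> x \<in> positions B p \<and> y < card A \<and> y \<notin> positions B p \<and>
     positions B q = insert y (positions B p - {x}))"

lemma nearI:
  "\<lbrakk>(p, q) \<in> E; x \<in> positions B p; y < card A; y \<notin> positions B p;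
    positions B q = insert y (positions B p - {x})\<rbrakk> \<Longrightarrow> near p"
  by (auto simp: near_def)

text \<open>Transpositions within the position set of \<open>p\<close>, or within its complement,
  fix \<open>p\<close> and carry the known neighbour to the desired one. That \<open>q\<close> is
  again \<open>near\<close> allows iteration along paths.\<close>

lemma near_neighbour:
  assumes "near p" "x' \<in> positions B p" "y' < card A" "y' \<notin> positions B p"
  obtains q where "(p, q) \<in> E" "near q" "positions B q = insert y' (positions B p - {x'})"
proof -
  let ?S = "positions B p"
  obtain q x y where q: "(p, q) \<in> E" and x: "x \<in> ?S" and y: "y < card A" "y \<notin> ?S"
    and pq: "positions B q = insert y (?S - {x})"
    using assms(1) by (auto simp: near_def)
  have lt: "k < card A" if "k \<in> ?S" for k
    using that q E_X positions_linear_extension by blast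
  \<comment> \<open>First the removed element is changed from \<open>x\<close> to \<open>x'\<close>;
    afterwards the inserted one is changed from \<open>y\<close> to \<open>y'\<close>.\<close>
  obtain q1 where q1: "(p, q1) \<in> E" "positions B q1 = transpose x x' ` insert y (?S - {x})"
    using fixed_by_transposition[OF q lt lt] x assms(2) pq by metis
  have s1: "transpose x x' ` insert y (?S - {x}) = insert y (?S - {x'})"
    using x assms(2) y by (auto simp: transpose_def image_iff)
  obtain q2 where q2: "(p, q2) \<in> E" "positions B q2 = transpose y y' ` insert y (?S - {x'})"
    using fixed_by_transposition[OF q1(1) y(1) assms(3)] y assms(4) q1 s1 by metis
  have s2: "transpose y y' ` insert y (?S - {x'}) = insert y' (?S - {x'})"
    using assms(2,4) y by (auto simp: transpose_def image_iff)
  have pos: "positions B q2 = insert y' (?S - {x'})"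
    using q2(2) s2 by simp
  \<comment> \<open>The witness is \<open>p\<close>, reached from \<open>q2\<close> by exchanging
    \<open>y'\<close> back for \<open>x'\<close>.\<close>
  have "near q2"
    by (rule nearI[OF E_sym[OF q2(1)], of y' x']) (use pos assms(2,4) lt[OF assms(2)] in auto)
  then show thesis
    using that q2(1) pos by blast
qed

text \<open>This is connectedness of the Johnson graph: exchanging an element of
  \<open>?S - ?T\<close> for one of \<open>?T - ?S\<close> brings the position set closer to that of
  \<open>q\<close>.\<close>

lemma near_imp_related:
  assumes "near p" "q \<in> X"
  shows "(p, q) \<in> E"
  using assms(1)
proof (induction "card (positions B p - positions B q)" arbitrary: p rule: less_induct)
  case less
  have p: "p \<in> X"
    using less.prems E_X by (auto simp: near_def)
  let ?S = "positions B p" and ?T = "positions B q"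
  have card: "card ?S = card ?T"
    using card_positions[OF p] card_positions[OF assms(2)] union by auto
  show ?case
  proof (cases "?S = ?T")
    case True
    then show ?thesis
      using positions_inj[OF p assms(2)] E_refl[OF p] by simp
  next
    case False
    then obtain x y where xy: "x \<in> ?S - ?T" "y \<in> ?T - ?S"
      using equal_card_differ[OF _ _ card] by auto
    then have "y < card A"
      using positions_linear_extension[OF assms(2)] by auto
    then obtain p' where p': "(p, p') \<in> E" "near p'" "positions B p' = insert y (?S - {x})"
      using near_neighbour[OF less.prems] xy by blast
    have "positions B p' - ?T \<subset> ?S - ?T"
      using p'(3) xy by auto
    then have "card (positions B p' - ?T) < card (?S - ?T)"
      by (intro psubset_card_mono) auto
    then show ?thesis
      using less.hyps p' E_trans by blast
  qed
qed

text \<open>It suffices that \<open>q\<close> is \<open>near\<close>, since its class is then all of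
  \<open>X\<close>.\<close>

lemma full_if_nontrivial:
  assumes pq: "(p, q) \<in> E" "p \<noteq> q" and card: "card B \<noteq> card C \<or> card B = 1 \<and> card C = 1"
  shows "E = X \<times> X"
proof -
  have X: "p \<in> X" "q \<in> X"
    using pq E_X by auto
  let ?S = "positions B p" and ?T = "positions B q"
  have sub: "?S \<subseteq> {..<card A}" "?T \<subseteq> {..<card A}"
    using X positions_linear_extension by blast+
  have cards: "card ?S = card B" "card ?T = card B"
    using card_positions X union by blast+
  have "?S \<noteq> ?T"
    using positions_inj[OF X] pq by blast
  then obtain a b where ab: "a \<in> ?S - ?T" "b \<in> ?T - ?S"
    using equal_card_differ[of ?S ?T] cards by auto
  have lt: "a < card A" "b < card A"
    using ab sub by auto
  have "near q"
  proof (cases "\<exists>c < card A. c \<in> ?S \<longleftrightarrow> c \<in> ?T")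
    case True
    then obtain c where c: "c < card A" "c \<in> ?S \<longleftrightarrow> c \<in> ?T"
      by blast
    show ?thesis
    proof (cases "c \<in> ?S")
      case True
      \<comment> \<open>Both \<open>c\<close> and \<open>a\<close> lie in \<open>?S\<close>, but
        only \<open>c\<close> lies in \<open>?T\<close>; so \<open>?S\<close> is fixed and
        \<open>?T\<close> changes by one exchange.\<close>
      then obtain q' where q': "(p, q') \<in> E" "positions B q' = transpose c a ` ?T"
        using fixed_by_transposition[OF pq(1) c(1) lt(1)] ab by blast
      then show ?thesis
        using nearI[of q q' c a] transpose_image_exchange[of c ?T a] True c ab lt
          E_trans[OF E_sym[OF pq(1)]] by auto
    next
      case False
      \<comment> \<open>Here \<open>b\<close> and \<open>c\<close> both lie outside
        \<open>?S\<close>, and only \<open>b\<close> lies in \<open>?T\<close>.\<close>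
      then obtain q' where q': "(p, q') \<in> E" "positions B q' = transpose b c ` ?T"
        using fixed_by_transposition[OF pq(1) lt(2) c(1)] ab by blast
      then show ?thesis
        using nearI[of q q' b c] transpose_image_exchange[of b ?T c] False c ab lt
          E_trans[OF E_sym[OF pq(1)]] by auto
    qed
  next
    case False
    \<comment> \<open>Complementary position sets force \<open>card B = card C\<close>, so both are
      1; then \<open>?S\<close> and \<open>?T\<close> are singletons and already neighbours.\<close>
    then have T: "?S = {..<card A} - ?T"
      using sub by auto
    then have "card ?S = card A - card ?T"
      using sub by (simp add: card_Diff_subset)
    then have "card B = 1" "card C = 1"
      using cards card_A card by auto
    then have "?T = {b}" "?S = {a}"
      using cards ab by (auto simp: card_1_singleton_iff)
    then show ?thesis
      using nearI[of q p b a] E_sym[OF pq(1)] lt ab by auto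
  qed
  then have "(u, v) \<in> E" if "u \<in> X" "v \<in> X" for u v
    using near_imp_related that E_sym E_trans by blast
  then show ?thesis
    using E_X by auto
qed

end

section \<open>Sufficiency and the characterization\<close>

context disjoint_chains
begin

lemma LE_primitive_if_card:
  assumes "card B \<noteq> card C \<or> card B = 1 \<and> card C = 1"
  shows "LE_primitive A r"
  unfolding LE_primitive_iff_equiv[OF finite]
proof (intro allI impI, elim conjE)
  fix E
  assume eq: "equiv X E"
    and inv: "\<forall>i \<in> {1..card A - 1}. \<forall>(p, q) \<in> E. (bk_move r i p, bk_move r i q) \<in> E"
  interpret invariant_equiv A r B C E
  proof
    show "(bk_move r i p, bk_move r i q) \<in> E" if "i \<in> {1..card A - 1}" "(p, q) \<in> E" for i p q
      using bspec[OF bspec[OF inv that(1)] that(2)] by simp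
  qed (rule eq)
  show "E = Id_on X \<or> E = X \<times> X"
  proof (cases "\<exists>p q. (p, q) \<in> E \<and> p \<noteq> q")
    case True
    then show ?thesis
      using full_if_nontrivial[OF _ _ assms] by blast
  next
    case False
    then show ?thesis
      using E_X E_refl by auto
  qed
qed

end

text \<open>The summands are the preimages of the two halves under the isomorphism, and
  (in)comparability is pulled back along it.\<close>

lemma is_sum_of_two_chains_disjoint_chains:
  assumes "finite A" "partial_order_on A r" "1 \<le> m" "1 \<le> n" "is_sum_of_two_chains A r m n"
  obtains B C where "disjoint_chains A r B C" "card B = m" "card C = n"
proof -
  let ?s = "disjoint_sum_rel (chain_rel m) (chain_rel n)"
  obtain f where bij: "bij_betw f A ({..<m} <+> {..<n})"
    and f: "\<And>x y. x \<in> A \<Longrightarrow> y \<in> A \<Longrightarrow> (x, y) \<in> r \<longleftrightarrow> (f x, f y) \<in> ?s"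
    using assms(5) by (auto simp: is_sum_of_two_chains_def poset_iso_def)
  define B where "B = {x \<in> A. f x \<in> Inl ` {..<m}}"
  define C where "C = {x \<in> A. f x \<in> Inr ` {..<n}}"
  have im: "f ` A = Inl ` {..<m} \<union> Inr ` {..<n}"
    using bij by (auto simp: bij_betw_def Plus_def)
  have inj: "inj_on f B" "inj_on f C"
    using bij by (auto simp: bij_betw_def B_def C_def intro: inj_on_subset)
  have "f ` {x \<in> A. f x \<in> S} = f ` A \<inter> S" for S
    by auto
  then have "f ` B = Inl ` {..<m}" "f ` C = Inr ` {..<n}"
    unfolding B_def C_def im by auto
  then have cards: "card B = m" "card C = n"
    using card_image[OF inj(1)] card_image[OF inj(2)] by (simp_all add: card_image)
  have "disjoint_chains A r B C"
  proof
    show "B \<noteq> {}" "C \<noteq> {}"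
      using cards assms(3,4) by auto
    show "B \<union> C = A"
      using im by (auto simp: B_def C_def)
    show "B \<inter> C = {}"
      by (auto simp: B_def C_def)
    show "incomparable r b c" if "b \<in> B" "c \<in> C" for b c
      using that f by (auto simp: B_def C_def incomparable_def)
    show "\<not> incomparable r x y" if "x \<in> B" "y \<in> B" for x y
      using that f by (auto simp: B_def incomparable_def chain_rel_def)
    show "\<not> incomparable r x y" if "x \<in> C" "y \<in> C" for x y
      using that f by (auto simp: C_def incomparable_def chain_rel_def)
  qed (use assms in auto)
  then show thesis
    using that cards by blast
qed

theorem theorem4p10:
  fixes A :: "'a set" and r :: "'a rel"
  assumes "finite A" and "partial_order_on A r" and "poset_disconnected A r"
  shows "LE_primitive A r \<longleftrightarrow>
    (\<exists>n1 n2 :: nat. n1 \<ge> 1 \<and> n2 \<ge> 1 \<and> is_sum_of_two_chains A r n1 n2 \<and>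
       (n1 \<noteq> n2 \<or> (n1 = 1 \<and> n2 = 1)))"
proof
  assume prim: "LE_primitive A r"
  obtain B C where BC: "B \<noteq> {}" "C \<noteq> {}" "B \<union> C = A" "B \<inter> C = {}"
    "\<forall>b \<in> B. \<forall>c \<in> C. incomparable r b c"
    using assms(3) unfolding poset_disconnected_def by (elim exE conjE)
  interpret disjoint_posets A r B C
    by unfold_locales (use assms(1,2) BC in auto)
  \<comment> \<open>The chain property of \<open>C\<close> is that of \<open>B\<close> with the
    summands interchanged.\<close>
  interpret disjoint_chains A r B C
    by unfold_locales
      (fact LE_primitive_imp_chain[OF prim] disjoint_posets.LE_primitive_imp_chain[OF swapped prim])+
  show "\<exists>n1 n2 :: nat. n1 \<ge> 1 \<and> n2 \<ge> 1 \<and> is_sum_of_two_chains A r n1 n2 \<and>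
      (n1 \<noteq> n2 \<or> (n1 = 1 \<and> n2 = 1))"
    using is_sum_of_two_chains card_pos LE_primitive_imp_card[OF prim]
    by (intro exI[of _ "card B"] exI[of _ "card C"]) auto
next
  assume "\<exists>n1 n2 :: nat. n1 \<ge> 1 \<and> n2 \<ge> 1 \<and> is_sum_of_two_chains A r n1 n2 \<and>
      (n1 \<noteq> n2 \<or> (n1 = 1 \<and> n2 = 1))"
  then obtain m n :: nat where mn: "1 \<le> m" "1 \<le> n" "is_sum_of_two_chains A r m n"
    "m \<noteq> n \<or> (m = 1 \<and> n = 1)"
    by blast
  then obtain B C where "disjoint_chains A r B C" "card B = m" "card C = n"
    using is_sum_of_two_chains_disjoint_chains[OF assms(1,2)] by blast
  then show "LE_primitive A r"
    using disjoint_chains.LE_primitive_if_card mn(4) by blast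
qed

end
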